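(* The error $e_n=\hat{s}_n-s_n$ in compensated summation of $x_1,\ldots,x_n$ equals $$e_n=s_n\sigma_n+\sum_{j=4}^n x_j\eta_j\prod_{k=j}^n(1+\sigma_k)+\sum_{j=2}^{n-1}\bigl(s_j\sigma_j-\hat{c}_j(1+\eta_{j+1})\bigr)\prod_{k=j+1}^n(1+\sigma_k)$$ and $$e_n=s_n\sigma_n+\left(X_n+E_{n-1}\right)(1+\sigma_n),$$ where $$X_n\equiv x_n\eta_n(1+\beta_n)+\sum_{j=2}^{n-1}x_j(\eta_j-\delta_j)\prod_{\ell=j}^{n-1}(1+\beta_\ell)(1+\eta_{\ell+1}),$$ $$\Theta_k\equiv 1-(1+\delta_k)(1+\beta_k)(1+\eta_{k+1}),\qquad 2\le k\le n-1,$$ $$E_{n-1}\equiv e_{n-1}\Theta_{n-1}+\sum_{j=2}^{n-2}e_j(\Theta_j+\delta_{j+1})\prod_{\ell=j+1}^{n-1}(1+\beta_\ell)(1+\eta_{\ell+1}).$$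
   Context: Let $x_1,\ldots,x_n$ be floating point numbers (stored exactly), $s_k=\sum_{j=1}^k x_j$ the exact partial sums, and $u$ the unit roundoff; no overflow or underflow occurs. The finite precision model of compensated (Kahan) summation is $$\hat{s}_1=s_1=x_1,\qquad\hat{c}_1=0,$$ and for $2\le k\le n$ $$\hat{y}_k=(x_k-\hat{c}_{k-1})(1+\eta_k),\quad \hat{s}_k=(\hat{s}_{k-1}+\hat{y}_k)(1+\sigma_k),\quad \hat{c}_k=\bigl((\hat{s}_k-\hat{s}_{k-1})(1+\delta_k)-\hat{y}_k\bigr)(1+\beta_k),$$ with $\eta_2=0$ and $|\eta_k|,|\sigma_k|,|\delta_k|,|\beta_k|\le u$. The computed sum is $\hat{s}_n$, and the errors are $e_k=\hat{s}_k-s_k$, so $e_1=0$. Empty sums equal $0$.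
   Formalization: In the first identity the sum of x_j η_j ∏(1+σ_k) is taken from j=3 instead of j=4, and the leading term of X_n is x_n η_n instead of x_n η_n(1+β_n); as printed both identities fail, e.g. n=3, x=(0,0,1), η_3=β_3=u>0, other perturbations 0. *)

theory Defs
  imports Complex_Main
begin

definition partial_sum :: "(nat \<Rightarrow> real) \<Rightarrow> nat \<Rightarrow> real" where
  "partial_sum x k = (\<Sum>j = 1..k. x j)"

text \<open>Finite precision model of Kahan summation, with hatted quantities written \<open>sh\<close>, \<open>yh\<close>, \<open>ch\<close>.
  Sequences are 1-based; values outside the index ranges below are unconstrained.  In the absence of
  overflow and underflow, floating point numbers enter only as real numbers, so the inputs
  are arbitrary reals.\<close>

definition compensated_summation_model ::
  "real \<Rightarrow> nat \<Rightarrow> (nat \<Rightarrow> real) \<Rightarrow> (nat \<Rightarrow> real) \<Rightarrow> (nat \<Rightarrow> real) \<Rightarrow> (nat \<Rightarrow> real) \<Rightarrow>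
    (nat \<Rightarrow> real) \<Rightarrow> (nat \<Rightarrow> real) \<Rightarrow> (nat \<Rightarrow> real) \<Rightarrow> (nat \<Rightarrow> real) \<Rightarrow> bool" where
  "compensated_summation_model u n x yh sh ch \<eta> \<sigma> \<delta> \<beta> \<longleftrightarrow>
     sh 1 = x 1 \<and> ch 1 = 0 \<and> \<eta> 2 = 0 \<and>
     (\<forall>k\<in>{2..n}.
        yh k = (x k - ch (k - 1)) * (1 + \<eta> k) \<and>
        sh k = (sh (k - 1) + yh k) * (1 + \<sigma> k) \<and>
        ch k = ((sh k - sh (k - 1)) * (1 + \<delta> k) - yh k) * (1 + \<beta> k) \<and>
        \<bar>\<eta> k\<bar> \<le> u \<and> \<bar>\<sigma> k\<bar> \<le> u \<and> \<bar>\<delta> k\<bar> \<le> u \<and> \<bar>\<beta> k\<bar> \<le> u)"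

definition summation_error :: "(nat \<Rightarrow> real) \<Rightarrow> (nat \<Rightarrow> real) \<Rightarrow> nat \<Rightarrow> real" where
  "summation_error x sh k = sh k - partial_sum x k"

text \<open>The source prints the leading term of \<open>X\<^sub>n\<close> as \<open>x\<^sub>n \<eta>\<^sub>n (1 + \<beta>\<^sub>n)\<close>, and it starts the sum of
  the terms \<open>x\<^sub>j \<eta>\<^sub>j\<close> in the first expansion of \<open>e\<^sub>n\<close> at \<open>j = 4\<close>.  Neither is compatible with the
  model: \<open>\<beta>\<^sub>n\<close> enters only the unused correction \<open>ch n\<close>, and only \<open>\<eta> 2\<close> is known to vanish, so the
  term with \<open>j = 3\<close> cannot be dropped.  With \<open>n = 3\<close>, \<open>x = (0, 0, 1)\<close>, \<open>\<eta> 3 = \<beta> 3 = u > 0\<close> and all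
  other perturbations zero, the error is \<open>u\<close>, while the printed expansions
  give \<open>0\<close> (first) and \<open>u (1 + u)\<close> (second).
  Here the factor \<open>1 + \<beta>\<^sub>n\<close> is omitted and that sum is to be taken from \<open>j = 3\<close>.\<close>

definition comp_X ::
  "(nat \<Rightarrow> real) \<Rightarrow> (nat \<Rightarrow> real) \<Rightarrow> (nat \<Rightarrow> real) \<Rightarrow> (nat \<Rightarrow> real) \<Rightarrow> nat \<Rightarrow> real" where
  "comp_X x \<eta> \<delta> \<beta> n =
     x n * \<eta> n +
     (\<Sum>j = 2..n - 1. x j * (\<eta> j - \<delta> j) * (\<Prod>l = j..n - 1. (1 + \<beta> l) * (1 + \<eta> (l + 1))))"

definition comp_Theta ::
  "(nat \<Rightarrow> real) \<Rightarrow> (nat \<Rightarrow> real) \<Rightarrow> (nat \<Rightarrow> real) \<Rightarrow> nat \<Rightarrow> real" where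
  "comp_Theta \<eta> \<delta> \<beta> k = 1 - (1 + \<delta> k) * (1 + \<beta> k) * (1 + \<eta> (k + 1))"

text \<open>\<open>comp_E x sh \<eta> \<delta> \<beta> m\<close> is \<open>E\<^sub>m\<close>, to be used at \<open>m = n - 1\<close>.  For \<open>m = 1\<close> it mentions \<open>\<Theta>\<^sub>1\<close>, which
  has no counterpart in the model, but only multiplied by \<open>e\<^sub>1 = 0\<close>.\<close>

definition comp_E ::
  "(nat \<Rightarrow> real) \<Rightarrow> (nat \<Rightarrow> real) \<Rightarrow> (nat \<Rightarrow> real) \<Rightarrow> (nat \<Rightarrow> real) \<Rightarrow> (nat \<Rightarrow> real) \<Rightarrow> nat \<Rightarrow> real" where
  "comp_E x sh \<eta> \<delta> \<beta> m =
     summation_error x sh m * comp_Theta \<eta> \<delta> \<beta> m +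
     (\<Sum>j = 2..m - 1. summation_error x sh j * (comp_Theta \<eta> \<delta> \<beta> j + \<delta> (j + 1)) *
        (\<Prod>l = j + 1..m. (1 + \<beta> l) * (1 + \<eta> (l + 1))))"

end

theory Submission
  imports Defs
begin

text \<open>
  Both expansions are solutions of first-order linear recurrences.  Write \<open>e k\<close> for the error and
  \<open>d k = ch k * (1 + \<eta> (k + 1))\<close> for the computed correction as it enters the next step.
  Substituting \<open>sh k = partial_sum x k + e k\<close> into the model eliminates \<open>yh\<close> and \<open>sh\<close> and leaves
  (lemmas \<open>summation_error_Suc\<close> and \<open>correction_Suc\<close>)

  \<open>e k = partial_sum x k * \<sigma> k + (e (k - 1) + x k * \<eta> k - d (k - 1)) * (1 + \<sigma> k)\<close>,

  \<open>d k = (x k * (\<delta> k - \<eta> k) + (e k - e (k - 1)) * (1 + \<delta> k) + d (k - 1)) * p k\<close>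

  with \<open>p k = (1 + \<beta> k) * (1 + \<eta> (k + 1))\<close>.  Unrolling the first recurrence down to \<open>e 2\<close>, where
  \<open>\<eta> 2\<close>, \<open>d 1\<close> and \<open>e 1\<close> vanish, gives the first expansion
  (\<open>summation_error_expansion\<close>).

  For the second, the first recurrence is used only once, at \<open>k = n\<close>, so that it remains to
  expand \<open>e (n - 1) - d (n - 1)\<close> (\<open>corrected_error_expansion\<close>).  Unrolling the second
  recurrence leaves, for \<open>2 \<le> j \<le> n - 2\<close>, two contributions of \<open>e j\<close>, from the differences
  \<open>e j - e (j - 1)\<close> and \<open>e (j + 1) - e j\<close>.  They add up to the coefficient
  \<open>1 + \<delta> (j + 1) - (1 + \<delta> j) * p j = \<Theta> j + \<delta> (j + 1)\<close>, times the product of the later \<open>p l\<close>.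
  For \<open>j = n - 1\<close> the leading \<open>e (n - 1)\<close> takes the place of the second difference, which gives
  the coefficient \<open>\<Theta> (n - 1)\<close>, and \<open>e 1\<close> vanishes.  An induction on \<open>e m - d m\<close> performs this
  summation by parts one step at a time; \<open>comp_E_Suc\<close> is the matching recurrence for the
  claimed closed form.
\<close>

text \<open>These sums are Horner schemes: one more step multiplies everything accumulated so far, together
  with the newest term, by the new factor.  In the second form the weight of a term starts one
  factor later, so the newest term is the one with index \<open>m\<close>.\<close>

lemma sum_times_tail_prod_Suc:
  fixes f p :: "nat \<Rightarrow> 'a::comm_semiring_1"
  assumes "a \<le> Suc m"
  shows "(\<Sum>j = a..Suc m. f j * prod p {j..Suc m}) =
           (f (Suc m) + (\<Sum>j = a..m. f j * prod p {j..m})) * p (Suc m)"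
proof -
  have "(\<Sum>j = a..m. f j * prod p {j..Suc m}) = (\<Sum>j = a..m. f j * prod p {j..m} * p (Suc m))"
    by (rule sum.cong) (auto simp: algebra_simps)
  then show ?thesis
    using assms by (simp add: distrib_right add.commute flip: sum_distrib_right)
qed

lemma sum_times_strict_tail_prod_Suc:
  fixes f p :: "nat \<Rightarrow> 'a::comm_semiring_1"
  assumes "a \<le> m" "1 \<le> m"
  shows "(\<Sum>j = a..m. f j * prod p {j + 1..Suc m}) =
           (f m + (\<Sum>j = a..m - 1. f j * prod p {j + 1..m})) * p (Suc m)"
proof -
  obtain m' where m: "m = Suc m'"
    using assms by (cases m) auto
  have "(\<Sum>j = a..m. f j * prod p {j + 1..Suc m}) =
          (\<Sum>j = a..m. f j * prod p {j + 1..m}) * p (Suc m)"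
    unfolding sum_distrib_right by (rule sum.cong) (auto simp: algebra_simps)
  also have "(\<Sum>j = a..m. f j * prod p {j + 1..m}) =
               f m + (\<Sum>j = a..m - 1. f j * prod p {j + 1..m})"
    using assms by (simp add: m add.commute)
  finally show ?thesis .
qed

lemma partial_sum_Suc: "partial_sum x (Suc k) = partial_sum x k + x (Suc k)"
  by (simp add: partial_sum_def)

lemma summation_error_1:
  assumes "compensated_summation_model u n x yh sh ch \<eta> \<sigma> \<delta> \<beta>"
  shows "summation_error x sh 1 = 0"
  using assms
  by (simp add: compensated_summation_model_def summation_error_def partial_sum_def)

lemma summation_error_Suc:
  assumes model: "compensated_summation_model u n x yh sh ch \<eta> \<sigma> \<delta> \<beta>"
    and k: "1 \<le> k" "Suc k \<le> n"
  shows "summation_error x sh (Suc k) =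
           partial_sum x (Suc k) * \<sigma> (Suc k) +
           (summation_error x sh k + x (Suc k) * \<eta> (Suc k) - ch k * (1 + \<eta> (Suc k))) *
             (1 + \<sigma> (Suc k))"
proof -
  have "Suc k \<in> {2..n}"
    using k by simp
  then have yh: "yh (Suc k) = (x (Suc k) - ch k) * (1 + \<eta> (Suc k))"
    and sh: "sh (Suc k) = (sh k + yh (Suc k)) * (1 + \<sigma> (Suc k))"
    using model unfolding compensated_summation_model_def by (metis diff_Suc_1)+
  show ?thesis
    unfolding summation_error_def partial_sum_Suc sh yh by algebra
qed

lemma correction_Suc:
  assumes model: "compensated_summation_model u n x yh sh ch \<eta> \<sigma> \<delta> \<beta>"
    and k: "1 \<le> k" "Suc k \<le> n"
  shows "ch (Suc k) =
           (x (Suc k) * (\<delta> (Suc k) - \<eta> (Suc k)) +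
            (summation_error x sh (Suc k) - summation_error x sh k) * (1 + \<delta> (Suc k)) +
            ch k * (1 + \<eta> (Suc k))) * (1 + \<beta> (Suc k))"
proof -
  have "Suc k \<in> {2..n}"
    using k by simp
  then have yh: "yh (Suc k) = (x (Suc k) - ch k) * (1 + \<eta> (Suc k))"
    and ch: "ch (Suc k) = ((sh (Suc k) - sh k) * (1 + \<delta> (Suc k)) - yh (Suc k)) * (1 + \<beta> (Suc k))"
    using model unfolding compensated_summation_model_def by (metis diff_Suc_1)+
  show ?thesis
    unfolding summation_error_def partial_sum_Suc ch yh by algebra
qed

lemma summation_error_expansion:
  assumes model: "compensated_summation_model u n x yh sh ch \<eta> \<sigma> \<delta> \<beta>"
    and "2 \<le> m" "m \<le> n"
  shows "summation_error x sh m =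
           partial_sum x m * \<sigma> m +
           (\<Sum>j = 3..m. x j * \<eta> j * (\<Prod>k = j..m. 1 + \<sigma> k)) +
           (\<Sum>j = 2..m - 1. (partial_sum x j * \<sigma> j - ch j * (1 + \<eta> (j + 1))) *
              (\<Prod>k = j + 1..m. 1 + \<sigma> k))"
  using \<open>2 \<le> m\<close> \<open>m \<le> n\<close>
proof (induction m rule: dec_induct)
  case base
  have "ch 1 = 0" "\<eta> 2 = 0"
    using model by (simp_all add: compensated_summation_model_def)
  then show ?case
    using summation_error_Suc[OF model, of 1] summation_error_1[OF model] base
    by (simp add: numeral_2_eq_2)
next
  case (step m)
  let ?f = "\<lambda>j. partial_sum x j * \<sigma> j - ch j * (1 + \<eta> (j + 1))"
  let ?S = "\<Sum>j = 3..m. x j * \<eta> j * (\<Prod>k = j..m. 1 + \<sigma> k)"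
  let ?T = "\<Sum>j = 2..m - 1. ?f j * (\<Prod>k = j + 1..m. 1 + \<sigma> k)"
  have S: "(\<Sum>j = 3..Suc m. x j * \<eta> j * (\<Prod>k = j..Suc m. 1 + \<sigma> k)) =
             (x (Suc m) * \<eta> (Suc m) + ?S) * (1 + \<sigma> (Suc m))"
    using step.hyps by (intro sum_times_tail_prod_Suc) simp
  have T: "(\<Sum>j = 2..m. ?f j * (\<Prod>k = j + 1..Suc m. 1 + \<sigma> k)) =
             (?f m + ?T) * (1 + \<sigma> (Suc m))"
    using step.hyps by (intro sum_times_strict_tail_prod_Suc) simp_all
  have IH: "summation_error x sh m = partial_sum x m * \<sigma> m + ?S + ?T"
    using step by simp
  have "summation_error x sh (Suc m) =
          partial_sum x (Suc m) * \<sigma> (Suc m) +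
          (summation_error x sh m + x (Suc m) * \<eta> (Suc m) - ch m * (1 + \<eta> (Suc m))) *
            (1 + \<sigma> (Suc m))"
    using step by (intro summation_error_Suc[OF model]) simp_all
  also have "\<dots> = partial_sum x (Suc m) * \<sigma> (Suc m) +
                    (x (Suc m) * \<eta> (Suc m) + ?S) * (1 + \<sigma> (Suc m)) +
                    (?f m + ?T) * (1 + \<sigma> (Suc m))"
    unfolding IH by (simp add: algebra_simps)
  finally show ?case
    unfolding S T diff_Suc_1 .
qed

text \<open>In passing from \<open>m\<close> to \<open>Suc m\<close>, the leading term of \<open>comp_E\<close> becomes the last summand of the
  sum, and its coefficient grows from \<open>\<Theta> m\<close> to \<open>\<Theta> m + \<delta> (Suc m)\<close>.  The sum starts at \<open>j = 2\<close>, so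
  for \<open>m = 1\<close> there is no such summand; the identity survives because the first error is zero.\<close>

lemma comp_E_Suc:
  assumes "1 \<le> m" and e1: "summation_error x sh 1 = 0"
  shows "comp_E x sh \<eta> \<delta> \<beta> (Suc m) =
           summation_error x sh (Suc m) * comp_Theta \<eta> \<delta> \<beta> (Suc m) +
           (comp_E x sh \<eta> \<delta> \<beta> m + summation_error x sh m * \<delta> (Suc m)) *
             ((1 + \<beta> (Suc m)) * (1 + \<eta> (Suc m + 1)))"
proof (cases "m = 1")
  case True
  then show ?thesis
    using e1 by (simp add: comp_E_def)
next
  case False
  then have "2 \<le> m" "1 \<le> m"
    using assms by simp_all
  note sum_times_strict_tail_prod_Suc[OF this,
      of "\<lambda>j. summation_error x sh j * (comp_Theta \<eta> \<delta> \<beta> j + \<delta> (j + 1))"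
         "\<lambda>l. (1 + \<beta> l) * (1 + \<eta> (l + 1))"]
  then show ?thesis
    unfolding comp_E_def diff_Suc_1 by (simp add: algebra_simps)
qed

text \<open>The correction \<open>ch m\<close> approximates the error \<open>e m\<close> that it is meant to cancel; what remains of
  the error after the correction has been subtracted is again a combination of the data and the
  earlier errors, with every coefficient of first order in the perturbations.\<close>

lemma corrected_error_expansion:
  assumes model: "compensated_summation_model u n x yh sh ch \<eta> \<sigma> \<delta> \<beta>"
    and "1 \<le> m" "m \<le> n"
  shows "summation_error x sh m - ch m * (1 + \<eta> (m + 1)) =
           (\<Sum>j = 2..m. x j * (\<eta> j - \<delta> j) * (\<Prod>l = j..m. (1 + \<beta> l) * (1 + \<eta> (l + 1)))) +
           comp_E x sh \<eta> \<delta> \<beta> m"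
  using \<open>1 \<le> m\<close> \<open>m \<le> n\<close>
proof (induction m rule: dec_induct)
  case base
  then show ?case
    using model summation_error_1[OF model]
    by (simp add: comp_E_def compensated_summation_model_def)
next
  case (step m)
  let ?p = "\<lambda>l. (1 + \<beta> l) * (1 + \<eta> (l + 1))"
  let ?e = "summation_error x sh"
  let ?X = "\<Sum>j = 2..m. x j * (\<eta> j - \<delta> j) * prod ?p {j..m}"
  have X: "(\<Sum>j = 2..Suc m. x j * (\<eta> j - \<delta> j) * prod ?p {j..Suc m}) =
             (x (Suc m) * (\<eta> (Suc m) - \<delta> (Suc m)) + ?X) * ?p (Suc m)"
    using step.hyps by (intro sum_times_tail_prod_Suc) simp
  have E: "comp_E x sh \<eta> \<delta> \<beta> (Suc m) = ?e (Suc m) * comp_Theta \<eta> \<delta> \<beta> (Suc m) +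
             (comp_E x sh \<eta> \<delta> \<beta> m + ?e m * \<delta> (Suc m)) * ?p (Suc m)"
    using step.hyps by (intro comp_E_Suc summation_error_1[OF model]) simp
  have IH: "comp_E x sh \<eta> \<delta> \<beta> m = ?e m - ch m * (1 + \<eta> (Suc m)) - ?X"
    using step by simp
  have c: "ch (Suc m) =
             (x (Suc m) * (\<delta> (Suc m) - \<eta> (Suc m)) + (?e (Suc m) - ?e m) * (1 + \<delta> (Suc m)) +
              ch m * (1 + \<eta> (Suc m))) * (1 + \<beta> (Suc m))"
    using step by (intro correction_Suc[OF model]) simp_all
  show ?case
    unfolding X E IH c comp_Theta_def by algebra
qed

theorem theorem4p3:
  fixes u :: real and n :: nat
    and x yh sh ch \<eta> \<sigma> \<delta> \<beta> :: "nat \<Rightarrow> real"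
  assumes "2 \<le> n"
    and "compensated_summation_model u n x yh sh ch \<eta> \<sigma> \<delta> \<beta>"
  shows "summation_error x sh n =
           partial_sum x n * \<sigma> n +
           (\<Sum>j = 3..n. x j * \<eta> j * (\<Prod>k = j..n. 1 + \<sigma> k)) +
           (\<Sum>j = 2..n - 1. (partial_sum x j * \<sigma> j - ch j * (1 + \<eta> (j + 1))) *
              (\<Prod>k = j + 1..n. 1 + \<sigma> k)) \<and>
         summation_error x sh n =
           partial_sum x n * \<sigma> n +
           (comp_X x \<eta> \<delta> \<beta> n + comp_E x sh \<eta> \<delta> \<beta> (n - 1)) * (1 + \<sigma> n)"
proof -
  note model = assms(2)
  define m where "m = n - 1"
  have n: "n = Suc m" and m: "1 \<le> m"
    using assms(1) by (simp_all add: m_def)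
  have "summation_error x sh n =
          partial_sum x n * \<sigma> n +
          (x n * \<eta> n + (summation_error x sh m - ch m * (1 + \<eta> (m + 1)))) * (1 + \<sigma> n)"
    using summation_error_Suc[OF model m] by (simp add: n algebra_simps)
  also have "x n * \<eta> n + (summation_error x sh m - ch m * (1 + \<eta> (m + 1))) =
               comp_X x \<eta> \<delta> \<beta> n + comp_E x sh \<eta> \<delta> \<beta> (n - 1)"
    using corrected_error_expansion[OF model m] by (simp add: n comp_X_def)
  finally show ?thesis
    using summation_error_expansion[OF model assms(1) order_refl] by blast
qed

end
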